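(* Let $\mathfrak{S}$ be the nonself-adjoint $2$-graph algebra generated by an isometric representation $(S,T)$ of a single vertex $2$-graph $\mathbb{F}_\theta^+$. Given $k,l>0$, let $\mathfrak{J}_{k,l}$ be the WOT-closed right ideal of $\mathfrak{S}$ generated by the row-isometry $[ST]_{k,l}=[(ST)_w:d(w)=(k,l)]$ (i.e. by the operators $(ST)_w$ with $d(w)=(k,l)$). Then $\mathfrak{S}$ is a von Neumann algebra if and only if $\mathfrak{J}_{k,l}$ contains the identity.
   Context: Single vertex $2$-graph: for positive integers $m,n$ (with $m>1$ or $n>1$) and a permutation $\theta$ of $\{1,\ldots,m\}\times\{1,\ldots,n\}$, $\mathbb{F}_\theta^+$ is the unital cancellative semigroup generated by $e_1,\ldots,e_m,f_1,\ldots,f_n$, where the $e_i$ generate a copy of the free semigroup $\mathbb{F}_m^+$, the $f_j$ generate a copy of $\mathbb{F}_n^+$, and $e_if_j=f_{j'}e_{i'}$ whenever $\theta(i,j)=(i',j')$. Every $w\in\mathbb{F}_\theta^+$ is uniquely $w=e_uf_v$; its degree is $d(w)=(|u|,|v|)$. An isometric representation $(S,T)$ of $\mathbb{F}_\theta^+$ on a Hilbert space $\mathcal{H}$ consists of $S=[S_1,\ldots,S_m]$ and $T=[T_1,\ldots,T_n]$ with $S_i^*S_j=\delta_{i,j}I$, $T_k^*T_l=\delta_{k,l}I$, and $S_iT_j=T_{j'}S_{i'}$ whenever $\theta(i,j)=(i',j')$. For $w=e_uf_v$, $(ST)_w=S_uT_v$. The nonself-adjoint $2$-graph algebra $\mathfrak{S}$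 generated by $(S,T)$ is the unital WOT-closed algebra generated by all $S_i,T_j$. *)

theory Defs
  imports "HOL-Analysis.Analysis"
begin

section \<open>Complex Hilbert spaces\<close>

text \<open>
  The norm is the one of \<open>real_inner\<close>, so it is induced by the real part of the complex inner
  product, which is linear in its first argument. No separability is assumed.
\<close>

class complex_hilbert_space = real_inner + complete_space +
  fixes scaleC :: "complex \<Rightarrow> 'a \<Rightarrow> 'a" (infixr "*\<^sub>C" 75)
    and cinner :: "'a \<Rightarrow> 'a \<Rightarrow> complex"
  assumes scaleC_add_right: "c *\<^sub>C (x + y) = c *\<^sub>C x + c *\<^sub>C y"
    and scaleC_add_left: "(c + d) *\<^sub>C x = c *\<^sub>C x + d *\<^sub>C x"
    and scaleC_scaleC: "c *\<^sub>C d *\<^sub>C x = (c * d) *\<^sub>C x"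
    and scaleC_of_real: "complex_of_real r *\<^sub>C x = r *\<^sub>R x"
    and cinner_commute: "cinner x y = cnj (cinner y x)"
    and cinner_add_left: "cinner (x + y) z = cinner x z + cinner y z"
    and cinner_scaleC_left: "cinner (c *\<^sub>C x) y = c * cinner x y"
    and inner_eq_Re_cinner: "inner x y = Re (cinner x y)"

lemma norm_scaleC: "norm (c *\<^sub>C x) = cmod c * norm (x :: 'h::complex_hilbert_space)"
proof -
  have im: "Im (cinner x x) = 0"
    using cinner_commute[of x x] by (metis cnj.simps(2) neg_equal_zero)
  have "cinner (c *\<^sub>C x) (c *\<^sub>C x) = c * cnj c * cinner x x"
    by (metis cinner_commute cinner_scaleC_left complex_cnj_mult mult.assoc)
  also have "\<dots> = of_real ((cmod c)\<^sup>2) * cinner x x"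
    by (simp add: complex_mult_cnj cmod_power2)
  finally have "inner (c *\<^sub>C x) (c *\<^sub>C x) = (cmod c)\<^sup>2 * inner x x"
    using im by (simp add: inner_eq_Re_cinner)
  then show ?thesis
    by (simp add: norm_eq_sqrt_inner real_sqrt_mult)
qed

lemma bounded_linear_scaleC: "bounded_linear ((*\<^sub>C) c :: 'h::complex_hilbert_space \<Rightarrow> 'h)"
proof (rule bounded_linear_intro[where K = "cmod c"])
  fix x y :: 'h and r :: real
  show "c *\<^sub>C (x + y) = c *\<^sub>C x + c *\<^sub>C y" by (rule scaleC_add_right)
  show "c *\<^sub>C (r *\<^sub>R x) = r *\<^sub>R (c *\<^sub>C x)"
    by (metis mult.commute scaleC_of_real scaleC_scaleC)
  show "norm (c *\<^sub>C x) \<le> norm x * cmod c" by (simp add: norm_scaleC mult.commute)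
qed

section \<open>Bounded operators and operator algebras\<close>

text \<open>
  The library's type \<open>'h \<Rightarrow>\<^sub>L 'h\<close> consists of the bounded real-linear maps; \<open>B(H)\<close> is the subset
  of the complex-linear ones.
\<close>

definition bounded_ops :: "('h::complex_hilbert_space \<Rightarrow>\<^sub>L 'h) set" where
  "bounded_ops = {A. \<forall>c x. blinfun_apply A (c *\<^sub>C x) = c *\<^sub>C blinfun_apply A x}"

definition op_scaleC :: "complex \<Rightarrow> ('h::complex_hilbert_space \<Rightarrow>\<^sub>L 'h) \<Rightarrow> 'h \<Rightarrow>\<^sub>L 'h" where
  "op_scaleC c A = Blinfun (\<lambda>x. c *\<^sub>C blinfun_apply A x)"

lemma op_scaleC_apply: "blinfun_apply (op_scaleC c A) x = c *\<^sub>C blinfun_apply A x"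
  unfolding op_scaleC_def
  by (subst bounded_linear_Blinfun_apply)
    (auto intro!: bounded_linear_compose[OF bounded_linear_scaleC blinfun.bounded_linear_right])

text \<open>For \<open>A \<in> bounded_ops\<close> such a \<open>B\<close> exists, by the Riesz representation theorem.\<close>

definition op_adjoint :: "('h::complex_hilbert_space \<Rightarrow>\<^sub>L 'h) \<Rightarrow> 'h \<Rightarrow>\<^sub>L 'h" where
  "op_adjoint A =
    (THE B. \<forall>x y. cinner (blinfun_apply A x) y = cinner x (blinfun_apply B y))"

text \<open>
  The weak operator topology on \<open>B(H)\<close>: the coarsest one for which \<open>A \<mapsto> cinner (A x) y\<close> is
  continuous for all \<open>x\<close> and \<open>y\<close>. Here \<open>euclidean\<close> is the product topology on the function type
  \<open>'h \<times> 'h \<Rightarrow> complex\<close>.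
\<close>

definition wot :: "('h::complex_hilbert_space \<Rightarrow>\<^sub>L 'h) topology" where
  "wot = pullback_topology bounded_ops (\<lambda>A (x, y). cinner (blinfun_apply A x) y) euclidean"

definition unital_subalgebra :: "('h::complex_hilbert_space \<Rightarrow>\<^sub>L 'h) set \<Rightarrow> bool" where
  "unital_subalgebra \<AA> \<longleftrightarrow>
    \<AA> \<subseteq> bounded_ops \<and> id_blinfun \<in> \<AA> \<and>
    (\<forall>A\<in>\<AA>. \<forall>B\<in>\<AA>. A + B \<in> \<AA>) \<and>
    (\<forall>c. \<forall>A\<in>\<AA>. op_scaleC c A \<in> \<AA>) \<and>
    (\<forall>A\<in>\<AA>. \<forall>B\<in>\<AA>. A o\<^sub>L B \<in> \<AA>)"

definition von_neumann_algebra :: "('h::complex_hilbert_space \<Rightarrow>\<^sub>L 'h) set \<Rightarrow> bool" where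
  "von_neumann_algebra \<AA> \<longleftrightarrow>
    unital_subalgebra \<AA> \<and> (\<forall>A\<in>\<AA>. op_adjoint A \<in> \<AA>) \<and> closedin wot \<AA>"

definition wot_algebra_generated ::
  "('h::complex_hilbert_space \<Rightarrow>\<^sub>L 'h) set \<Rightarrow> ('h \<Rightarrow>\<^sub>L 'h) set" where
  "wot_algebra_generated X = \<Inter>{\<AA>. unital_subalgebra \<AA> \<and> closedin wot \<AA> \<and> X \<subseteq> \<AA>}"

text \<open>
  Closure under complex scalars is part of the last condition when \<open>\<AA>\<close> is a unital subalgebra.
\<close>

definition right_ideal ::
  "('h::complex_hilbert_space \<Rightarrow>\<^sub>L 'h) set \<Rightarrow> ('h \<Rightarrow>\<^sub>L 'h) set \<Rightarrow> bool" where
  "right_ideal \<AA> \<JJ> \<longleftrightarrow>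
    \<JJ> \<subseteq> \<AA> \<and> 0 \<in> \<JJ> \<and>
    (\<forall>A\<in>\<JJ>. \<forall>B\<in>\<JJ>. A + B \<in> \<JJ>) \<and>
    (\<forall>A\<in>\<JJ>. \<forall>B\<in>\<AA>. A o\<^sub>L B \<in> \<JJ>)"

definition wot_right_ideal_generated ::
  "('h::complex_hilbert_space \<Rightarrow>\<^sub>L 'h) set \<Rightarrow> ('h \<Rightarrow>\<^sub>L 'h) set \<Rightarrow> ('h \<Rightarrow>\<^sub>L 'h) set" where
  "wot_right_ideal_generated \<AA> X = \<Inter>{\<JJ>. right_ideal \<AA> \<JJ> \<and> closedin wot \<JJ> \<and> X \<subseteq> \<JJ>}"

section \<open>Single vertex 2-graphs\<close>

definition two_graph_data :: "nat \<Rightarrow> nat \<Rightarrow> (nat \<times> nat \<Rightarrow> nat \<times> nat) \<Rightarrow> bool" where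
  "two_graph_data m n \<theta> \<longleftrightarrow>
    m > 0 \<and> n > 0 \<and> (m > 1 \<or> n > 1) \<and> bij_betw \<theta> ({1..m} \<times> {1..n}) ({1..m} \<times> {1..n})"

datatype gen = Gen_e nat | Gen_f nat

abbreviation e_word :: "nat list \<Rightarrow> gen list" where "e_word \<equiv> map Gen_e"
abbreviation f_word :: "nat list \<Rightarrow> gen list" where "f_word \<equiv> map Gen_f"

definition gen_words :: "nat \<Rightarrow> nat \<Rightarrow> gen list set" where
  "gen_words m n = lists (Gen_e ` {1..m} \<union> Gen_f ` {1..n})"

text \<open>The congruence on words generated by the relations \<open>e\<^sub>i f\<^sub>j = f\<^sub>j\<^sub>' e\<^sub>i\<^sub>'\<close>.\<close>

inductive theta_eq :: "nat \<Rightarrow> nat \<Rightarrow> (nat \<times> nat \<Rightarrow> nat \<times> nat) \<Rightarrow> gen list \<Rightarrow> gen list \<Rightarrow> bool"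
  for m n \<theta> where
  commute: "i \<in> {1..m} \<Longrightarrow> j \<in> {1..n} \<Longrightarrow> \<theta> (i, j) = (i', j') \<Longrightarrow>
    theta_eq m n \<theta> (xs @ [Gen_e i, Gen_f j] @ ys) (xs @ [Gen_f j', Gen_e i'] @ ys)"
| refl: "theta_eq m n \<theta> xs xs"
| sym: "theta_eq m n \<theta> xs ys \<Longrightarrow> theta_eq m n \<theta> ys xs"
| trans: "theta_eq m n \<theta> xs ys \<Longrightarrow> theta_eq m n \<theta> ys zs \<Longrightarrow> theta_eq m n \<theta> xs zs"

text \<open>
  The class of a word in \<open>\<F>\<^sub>\<theta>\<^sup>+\<close>. The latter is the semigroup given by generators and
  relations: its elements are the classes, and the product is induced by concatenation.
\<close>

definition word_class ::
  "nat \<Rightarrow> nat \<Rightarrow> (nat \<times> nat \<Rightarrow> nat \<times> nat) \<Rightarrow> gen list \<Rightarrow> gen list set" where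
  "word_class m n \<theta> xs = {ys \<in> gen_words m n. theta_eq m n \<theta> xs ys}"

definition two_graph :: "nat \<Rightarrow> nat \<Rightarrow> (nat \<times> nat \<Rightarrow> nat \<times> nat) \<Rightarrow> gen list set set" where
  "two_graph m n \<theta> = word_class m n \<theta> ` gen_words m n"

definition degree ::
  "nat \<Rightarrow> nat \<Rightarrow> (nat \<times> nat \<Rightarrow> nat \<times> nat) \<Rightarrow> gen list set \<Rightarrow> nat \<times> nat" where
  "degree m n \<theta> w =
    (THE d. \<exists>u\<in>lists {1..m}. \<exists>v\<in>lists {1..n}.
      w = word_class m n \<theta> (e_word u @ f_word v) \<and> d = (length u, length v))"

definition isometric_representation ::
  "nat \<Rightarrow> nat \<Rightarrow> (nat \<times> nat \<Rightarrow> nat \<times> nat) \<Rightarrow>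
    (nat \<Rightarrow> 'h::complex_hilbert_space \<Rightarrow>\<^sub>L 'h) \<Rightarrow> (nat \<Rightarrow> 'h \<Rightarrow>\<^sub>L 'h) \<Rightarrow> bool" where
  "isometric_representation m n \<theta> S T \<longleftrightarrow>
    (\<forall>i\<in>{1..m}. S i \<in> bounded_ops) \<and> (\<forall>j\<in>{1..n}. T j \<in> bounded_ops) \<and>
    (\<forall>i\<in>{1..m}. \<forall>j\<in>{1..m}. op_adjoint (S i) o\<^sub>L S j = (if i = j then id_blinfun else 0)) \<and>
    (\<forall>k\<in>{1..n}. \<forall>l\<in>{1..n}. op_adjoint (T k) o\<^sub>L T l = (if k = l then id_blinfun else 0)) \<and>
    (\<forall>i\<in>{1..m}. \<forall>j\<in>{1..n}. \<forall>i' j'. \<theta> (i, j) = (i', j') \<longrightarrow> S i o\<^sub>L T j = T j' o\<^sub>L S i')"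

text \<open>\<open>word_op R [i\<^sub>1, \<dots>, i\<^sub>k]\<close> is the product \<open>R i\<^sub>1 \<cdots> R i\<^sub>k\<close>.\<close>

definition word_op :: "('i \<Rightarrow> 'h::real_normed_vector \<Rightarrow>\<^sub>L 'h) \<Rightarrow> 'i list \<Rightarrow> 'h \<Rightarrow>\<^sub>L 'h" where
  "word_op R xs = foldr (\<lambda>i A. R i o\<^sub>L A) xs id_blinfun"

definition ST_op ::
  "nat \<Rightarrow> nat \<Rightarrow> (nat \<times> nat \<Rightarrow> nat \<times> nat) \<Rightarrow>
    (nat \<Rightarrow> 'h::complex_hilbert_space \<Rightarrow>\<^sub>L 'h) \<Rightarrow> (nat \<Rightarrow> 'h \<Rightarrow>\<^sub>L 'h) \<Rightarrow>
    gen list set \<Rightarrow> 'h \<Rightarrow>\<^sub>L 'h" where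
  "ST_op m n \<theta> S T w =
    (THE A. \<exists>u\<in>lists {1..m}. \<exists>v\<in>lists {1..n}.
      w = word_class m n \<theta> (e_word u @ f_word v) \<and> A = word_op S u o\<^sub>L word_op T v)"

definition two_graph_algebra ::
  "nat \<Rightarrow> nat \<Rightarrow> (nat \<Rightarrow> 'h::complex_hilbert_space \<Rightarrow>\<^sub>L 'h) \<Rightarrow> (nat \<Rightarrow> 'h \<Rightarrow>\<^sub>L 'h) \<Rightarrow>
    ('h \<Rightarrow>\<^sub>L 'h) set" where
  "two_graph_algebra m n S T = wot_algebra_generated (S ` {1..m} \<union> T ` {1..n})"

definition degree_ideal ::
  "nat \<Rightarrow> nat \<Rightarrow> (nat \<times> nat \<Rightarrow> nat \<times> nat) \<Rightarrow>
    (nat \<Rightarrow> 'h::complex_hilbert_space \<Rightarrow>\<^sub>L 'h) \<Rightarrow> (nat \<Rightarrow> 'h \<Rightarrow>\<^sub>L 'h) \<Rightarrow>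
    nat \<Rightarrow> nat \<Rightarrow> ('h \<Rightarrow>\<^sub>L 'h) set" where
  "degree_ideal m n \<theta> S T k l =
    wot_right_ideal_generated (two_graph_algebra m n S T)
      {ST_op m n \<theta> S T w | w. w \<in> two_graph m n \<theta> \<and> degree m n \<theta> w = (k, l)}"

subsection \<open>The definite descriptions are well-defined\<close>

lemma theta_eq_append_left: "theta_eq m n \<theta> xs ys \<Longrightarrow> theta_eq m n \<theta> (zs @ xs) (zs @ ys)"
proof (induction rule: theta_eq.induct)
  case (commute i j i' j' xs ys)
  then show ?case using theta_eq.commute[of i m j n \<theta> i' j' "zs @ xs" ys] by simp
qed (rule theta_eq.refl, erule theta_eq.sym, erule (1) theta_eq.trans)

lemma theta_eq_append_right: "theta_eq m n \<theta> xs ys \<Longrightarrow> theta_eq m n \<theta> (xs @ zs) (ys @ zs)"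
proof (induction rule: theta_eq.induct)
  case (commute i j i' j' xs ys)
  then show ?case using theta_eq.commute[of i m j n \<theta> i' j' xs "ys @ zs"] by simp
qed (rule theta_eq.refl, erule theta_eq.sym, erule (1) theta_eq.trans)

lemma e_f_word_in_gen_words:
  "u \<in> lists {1..m} \<Longrightarrow> v \<in> lists {1..n} \<Longrightarrow> e_word u @ f_word v \<in> gen_words m n"
  by (auto simp: gen_words_def)

lemma word_class_eq_iff:
  assumes "ys \<in> gen_words m n"
  shows "word_class m n \<theta> xs = word_class m n \<theta> ys \<longleftrightarrow> theta_eq m n \<theta> xs ys"
proof
  assume "word_class m n \<theta> xs = word_class m n \<theta> ys"
  moreover have "ys \<in> word_class m n \<theta> ys"
    using assms by (simp add: word_class_def theta_eq.refl)
  ultimately have "ys \<in> word_class m n \<theta> xs"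
    by simp
  then show "theta_eq m n \<theta> xs ys"
    by (simp add: word_class_def)
next
  assume *: "theta_eq m n \<theta> xs ys"
  have "theta_eq m n \<theta> xs zs \<longleftrightarrow> theta_eq m n \<theta> ys zs" for zs
    using theta_eq.trans[OF *] theta_eq.trans[OF theta_eq.sym[OF *]] by (rule iffI[rotated])
  then show "word_class m n \<theta> xs = word_class m n \<theta> ys"
    by (simp add: word_class_def)
qed

lemma theta_eq_length_filter:
  "theta_eq m n \<theta> xs ys \<Longrightarrow>
    length (filter (\<lambda>g. \<exists>i. g = Gen_e i) xs) = length (filter (\<lambda>g. \<exists>i. g = Gen_e i) ys) \<and>
    length (filter (\<lambda>g. \<exists>i. g = Gen_f i) xs) = length (filter (\<lambda>g. \<exists>i. g = Gen_f i) ys)"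
  by (induction rule: theta_eq.induct) auto

lemma theta_eq_e_f_word_length:
  assumes "theta_eq m n \<theta> (e_word u @ f_word v) (e_word u' @ f_word v')"
  shows "length u = length u' \<and> length v = length v'"
  using theta_eq_length_filter[OF assms] by (simp add: filter_map o_def)

lemma degree_e_f_word:
  assumes "u \<in> lists {1..m}" "v \<in> lists {1..n}"
  shows "degree m n \<theta> (word_class m n \<theta> (e_word u @ f_word v)) = (length u, length v)"
  unfolding degree_def
proof (rule the_equality)
  fix d
  assume "\<exists>u'\<in>lists {1..m}. \<exists>v'\<in>lists {1..n}. word_class m n \<theta> (e_word u @ f_word v) =
    word_class m n \<theta> (e_word u' @ f_word v') \<and> d = (length u', length v')"
  then show "d = (length u, length v)"
    using theta_eq_e_f_word_length word_class_eq_iff[OF e_f_word_in_gen_words] by metis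
qed (use assms in blast)

lemma word_op_simps:
  "word_op R [] = id_blinfun" "word_op R (i # xs) = R i o\<^sub>L word_op R xs"
  by (simp_all add: word_op_def)

lemma word_op_append: "word_op R (xs @ ys) = word_op R xs o\<^sub>L word_op R ys"
  by (induction xs) (auto simp: word_op_simps intro!: blinfun_eqI)

lemma word_op_map: "word_op R (map h xs) = word_op (\<lambda>i. R (h i)) xs"
  by (induction xs) (auto simp: word_op_simps)

lemma theta_eq_word_op:
  assumes "isometric_representation m n \<theta> S T" "theta_eq m n \<theta> xs ys"
  shows "word_op (case_gen S T) xs = word_op (case_gen S T) ys"
  using assms(2)
proof (induction rule: theta_eq.induct)
  case (commute i j i' j' xs ys)
  then have "S i o\<^sub>L T j = T j' o\<^sub>L S i'"
    using assms(1) by (simp add: isometric_representation_def)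
  moreover have "A o\<^sub>L id_blinfun = A" for A :: "'a \<Rightarrow>\<^sub>L 'a"
    by (auto intro: blinfun_eqI)
  ultimately have "word_op (case_gen S T) [Gen_e i, Gen_f j] =
      word_op (case_gen S T) [Gen_f j', Gen_e i']"
    by (simp add: word_op_simps)
  then show ?case by (simp only: word_op_append)
qed auto

lemma ST_op_e_f_word:
  assumes "isometric_representation m n \<theta> S T" "u \<in> lists {1..m}" "v \<in> lists {1..n}"
  shows "ST_op m n \<theta> S T (word_class m n \<theta> (e_word u @ f_word v)) = word_op S u o\<^sub>L word_op T v"
  unfolding ST_op_def
proof (rule the_equality)
  have *: "word_op (case_gen S T) (e_word a @ f_word b) = word_op S a o\<^sub>L word_op T b" for a b
    by (simp add: word_op_append word_op_map)
  fix A
  assume "\<exists>u'\<in>lists {1..m}. \<exists>v'\<in>lists {1..n}. word_class m n \<theta> (e_word u @ f_word v) =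
    word_class m n \<theta> (e_word u' @ f_word v') \<and> A = word_op S u' o\<^sub>L word_op T v'"
  then obtain u' v' where "u' \<in> lists {1..m}" "v' \<in> lists {1..n}"
      and eq: "word_class m n \<theta> (e_word u @ f_word v) = word_class m n \<theta> (e_word u' @ f_word v')"
      and A: "A = word_op S u' o\<^sub>L word_op T v'"
    by blast
  then have "theta_eq m n \<theta> (e_word u @ f_word v) (e_word u' @ f_word v')"
    using word_class_eq_iff[OF e_f_word_in_gen_words] by metis
  from theta_eq_word_op[OF assms(1) this] show "A = word_op S u o\<^sub>L word_op T v"
    by (simp add: * A)
qed (use assms in blast)

lemma theta_eq_f_e_word:
  assumes "two_graph_data m n \<theta>" "u \<in> lists {1..m}" "j \<in> {1..n}"
  shows "\<exists>u'\<in>lists {1..m}. \<exists>j'\<in>{1..n}. theta_eq m n \<theta> (Gen_f j # e_word u) (e_word u' @ [Gen_f j'])"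
  using assms(2,3)
proof (induction u arbitrary: j)
  case Nil
  then show ?case by (intro bexI[of _ "[]"] bexI[of _ j]) (auto intro: theta_eq.refl)
next
  case (Cons i u)
  then have i: "i \<in> {1..m}" and u: "u \<in> lists {1..m}" by auto
  have "\<theta> ` ({1..m} \<times> {1..n}) = {1..m} \<times> {1..n}"
    using assms(1) by (simp add: two_graph_data_def bij_betw_def)
  then have "(i, j) \<in> \<theta> ` ({1..m} \<times> {1..n})"
    using i Cons.prems by blast
  then obtain i0 j0 where ij: "\<theta> (i0, j0) = (i, j)" "i0 \<in> {1..m}" "j0 \<in> {1..n}"
    by force
  obtain u' j' where u': "u' \<in> lists {1..m}" "j' \<in> {1..n}"
      "theta_eq m n \<theta> (Gen_f j0 # e_word u) (e_word u' @ [Gen_f j'])"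
    using Cons.IH[OF ij(3)] by blast
  have "theta_eq m n \<theta> (Gen_f j # e_word (i # u)) (Gen_e i0 # Gen_f j0 # e_word u)"
    using theta_eq.sym[OF theta_eq.commute[of i0 m j0 n \<theta> i j "[]" "e_word u"]] ij by simp
  moreover have "theta_eq m n \<theta> (Gen_e i0 # Gen_f j0 # e_word u) (e_word (i0 # u') @ [Gen_f j'])"
    using theta_eq_append_left[OF u'(3), of "[Gen_e i0]"] by simp
  ultimately have "theta_eq m n \<theta> (Gen_f j # e_word (i # u)) (e_word (i0 # u') @ [Gen_f j'])"
    by (rule theta_eq.trans)
  then show ?case using u' ij by (intro bexI[of _ "i0 # u'"] bexI[of _ j']) auto
qed

lemma theta_eq_e_f_word_exists:
  assumes "two_graph_data m n \<theta>" "xs \<in> gen_words m n"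
  shows "\<exists>u\<in>lists {1..m}. \<exists>v\<in>lists {1..n}. theta_eq m n \<theta> xs (e_word u @ f_word v)"
  using assms(2) unfolding gen_words_def
proof (induction xs rule: lists.induct)
  case Nil
  show ?case by (intro bexI[of _ "[]"]) (auto intro: theta_eq.refl)
next
  case (Cons g xs)
  then obtain u v where uv: "u \<in> lists {1..m}" "v \<in> lists {1..n}"
      "theta_eq m n \<theta> xs (e_word u @ f_word v)" by blast
  have g: "theta_eq m n \<theta> (g # xs) (g # e_word u @ f_word v)"
    using theta_eq_append_left[OF uv(3), of "[g]"] by simp
  from Cons.hyps(1) consider i where "g = Gen_e i" "i \<in> {1..m}" | j where "g = Gen_f j" "j \<in> {1..n}"
    by blast
  then show ?case
  proof cases
    case 1
    then show ?thesis using g uv by (intro bexI[of _ "i # u"] bexI[of _ v]) auto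
  next
    case 2
    obtain u' j' where u': "u' \<in> lists {1..m}" "j' \<in> {1..n}"
        "theta_eq m n \<theta> (Gen_f j # e_word u) (e_word u' @ [Gen_f j'])"
      using theta_eq_f_e_word[OF assms(1) uv(1) 2(2)] by blast
    have "theta_eq m n \<theta> (g # e_word u @ f_word v) (e_word u' @ f_word (j' # v))"
      using theta_eq_append_right[OF u'(3), of "f_word v"] 2 by simp
    with g have "theta_eq m n \<theta> (g # xs) (e_word u' @ f_word (j' # v))"
      by (rule theta_eq.trans)
    then show ?thesis using u' uv by (intro bexI[of _ u'] bexI[of _ "j' # v"]) auto
  qed
qed

lemma two_graph_e_f_word:
  assumes "two_graph_data m n \<theta>" "w \<in> two_graph m n \<theta>"
  obtains u v where "u \<in> lists {1..m}" "v \<in> lists {1..n}"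
    "w = word_class m n \<theta> (e_word u @ f_word v)"
proof -
  from assms(2) obtain xs where xs: "xs \<in> gen_words m n" "w = word_class m n \<theta> xs"
    unfolding two_graph_def by blast
  obtain u v where uv: "u \<in> lists {1..m}" "v \<in> lists {1..n}"
      "theta_eq m n \<theta> xs (e_word u @ f_word v)"
    using theta_eq_e_f_word_exists[OF assms(1) xs(1)] by blast
  then have "w = word_class m n \<theta> (e_word u @ f_word v)"
    using xs(2) word_class_eq_iff[OF e_f_word_in_gen_words[OF uv(1,2)]] by simp
  with uv(1,2) show thesis by (rule that)
qed

end

theory Submission
  imports Defs
begin

text \<open>
  If \<open>\<SS>\<close> is self-adjoint, the range of the row isometry \<open>[ST]\<^sub>k\<^sub>,\<^sub>l\<close> is invariant and hence reducing
  for \<open>\<SS>\<close>. As each \<open>(ST)\<^sub>w\<^sup>* \<in> \<SS>\<close> maps that range onto the whole space, the range is everything, so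
  \<open>I = \<Sum>\<^sub>w (ST)\<^sub>w (ST)\<^sub>w\<^sup>* \<in> \<JJ>\<^sub>k\<^sub>,\<^sub>l\<close>. Conversely, every \<open>A \<in> \<JJ>\<^sub>k\<^sub>,\<^sub>l\<close> equals \<open>\<Sum>\<^sub>w (ST)\<^sub>w (ST)\<^sub>w\<^sup>* A\<close>
  with \<open>(ST)\<^sub>w\<^sup>* A \<in> \<SS>\<close>. For \<open>A = I\<close> this puts all \<open>(ST)\<^sub>w\<^sup>*\<close> into \<open>\<SS>\<close>. If \<open>G\<close> is one of the \<open>S\<^sub>i, T\<^sub>j\<close>,
  then \<open>G\<^sup>* (ST)\<^sub>w \<in> \<SS>\<close>, because \<open>k, l > 0\<close> allow \<open>w\<close> to be written starting with either kind of
  generator; so \<open>G\<^sup>* = \<Sum>\<^sub>w (G\<^sup>* (ST)\<^sub>w) (ST)\<^sub>w\<^sup>* \<in> \<SS>\<close>.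
\<close>

section \<open>Adjoints\<close>

lemma cinner_scaleC_right: "cinner x (c *\<^sub>C y) = cnj c * cinner x y"
  by (metis cinner_commute cinner_scaleC_left complex_cnj_mult)

lemma cinner_add_right: "cinner x (y + z) = cinner x y + cinner x z"
  by (metis cinner_commute cinner_add_left complex_cnj_add)

text \<open>Together with \<open>inner_eq_Re_cinner\<close> this recovers \<open>cinner\<close> from
  \<open>inner\<close>, so a real representation theorem can yield complex adjoints.\<close>

lemma Im_cinner: "Im (cinner x y) = - inner (\<i> *\<^sub>C x) y"
  by (simp add: inner_eq_Re_cinner cinner_scaleC_left)

lemma cinner_zero_left: "cinner 0 x = 0"
  using cinner_add_left[of 0 0 x] by simp

lemma cinner_zero_right: "cinner x 0 = 0"
  using cinner_add_right[of x 0 0] by simp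

lemma cinner_diff_left: "cinner (x - y) z = cinner x z - cinner y z"
  by (metis add_diff_cancel_right' cinner_add_left diff_add_cancel)

lemma cinner_diff_right: "cinner x (y - z) = cinner x y - cinner x z"
  by (metis add_diff_cancel_right' cinner_add_right diff_add_cancel)

lemma cinner_ext_right:
  assumes "\<And>x. cinner x y = cinner x z"
  shows "y = z"
proof -
  have "inner x y = inner x z" for x
    by (simp add: inner_eq_Re_cinner assms)
  then have "inner (y - z) (y - z) = 0"
    by (metis inner_diff_right right_minus_eq)
  then show ?thesis by simp
qed

lemma cinner_ext_left:
  assumes "\<And>y. cinner x y = cinner z y"
  shows "x = z"
  using assms by (intro cinner_ext_right) (metis cinner_commute)

text \<open>The representing vector minimises \<open>\<parallel>x\<parallel>\<^sup>2 - 2 f x\<close>.\<close>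

lemma riesz_representation:
  fixes f :: "'a::{real_inner, complete_space} \<Rightarrow> real"
  assumes "bounded_linear f"
  shows "\<exists>z. \<forall>x. f x = inner x z"
proof -
  interpret f: bounded_linear f by fact
  define \<phi> where "\<phi> x = inner x x - 2 * f x" for x
  define m where "m = Inf (range \<phi>)"
  obtain K where K: "norm (f x) \<le> norm x * K" for x
    using f.bounded by blast
  \<comment> \<open>Completing the square in \<open>norm x\<close> bounds \<open>\<phi>\<close> from
    below, so its infimum \<open>m\<close> is a genuine lower bound.\<close>
  have "\<phi> x \<ge> - K\<^sup>2" for x
  proof -
    have "0 \<le> (norm x - K)\<^sup>2" by simp
    moreover have "f x \<le> norm x * K" using K[of x] by simp
    ultimately show ?thesis
      by (simp add: \<phi>_def power2_diff power2_norm_eq_inner)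
  qed
  then have bdd: "bdd_below (range \<phi>)" by (metis bdd_belowI2)
  then have m_le: "m \<le> \<phi> x" for x
    unfolding m_def by (simp add: cInf_lower)
  have "\<exists>x. \<phi> x < m + inverse (real (Suc n))" for n
  proof -
    have "m < m + inverse (real (Suc n))" by simp
    then show ?thesis
      using cInf_less_iff[OF _ bdd] unfolding m_def by blast
  qed
  then obtain X where X: "\<phi> (X n) < m + inverse (real (Suc n))" for n by metis
  \<comment> \<open>By the parallelogram law, with the value of \<open>\<phi>\<close> at the
    midpoint estimated by \<open>m\<close>. Near-minimisers are therefore close together, which
    makes \<open>X\<close> Cauchy.\<close>
  have par: "(norm (x - y))\<^sup>2 \<le> 2 * (\<phi> x - m) + 2 * (\<phi> y - m)" for x y
  proof -
    have "(norm (x - y))\<^sup>2 + 4 * \<phi> ((1/2) *\<^sub>R (x + y)) = 2 * \<phi> x + 2 * \<phi> y"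
      by (simp add: \<phi>_def power2_norm_eq_inner inner_simps f.add f.scaleR inner_commute field_simps)
    with m_le[of "(1/2) *\<^sub>R (x + y)"] show ?thesis by simp
  qed
  have "Cauchy X"
  proof (rule CauchyI)
    fix e :: real
    assume "e > 0"
    then have "e\<^sup>2 / 4 > 0" by simp
    then obtain N where N: "inverse (real (Suc N)) < e\<^sup>2 / 4"
      using reals_Archimedean by blast
    have close: "\<phi> (X p) - m < e\<^sup>2 / 4" if "p \<ge> N" for p
    proof -
      have "inverse (real (Suc p)) \<le> inverse (real (Suc N))" using that by simp
      with X[of p] N show ?thesis by linarith
    qed
    have "(norm (X p - X q))\<^sup>2 < e\<^sup>2" if "p \<ge> N" "q \<ge> N" for p q
      using par[of "X p" "X q"] close[OF that(1)] close[OF that(2)] by (simp add: field_simps)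
    then show "\<exists>M. \<forall>p\<ge>M. \<forall>q\<ge>M. norm (X p - X q) < e"
      using \<open>e > 0\<close> by (meson less_imp_le power_less_imp_less_base)
  qed
  then obtain z where z: "X \<longlonglongrightarrow> z"
    using Cauchy_convergent convergent_def by blast
  have "(\<lambda>n. \<phi> (X n)) \<longlonglongrightarrow> \<phi> z"
    unfolding \<phi>_def by (intro tendsto_intros z f.tendsto)
  moreover have "(\<lambda>n. m + inverse (real (Suc n))) \<longlonglongrightarrow> m + 0"
    by (intro tendsto_intros LIMSEQ_inverse_real_of_nat)
  ultimately have "\<phi> z \<le> m + 0"
    using X by (intro LIMSEQ_le) (auto intro: less_imp_le)
  then have min: "\<phi> z \<le> \<phi> y" for y
    using m_le[of y] by simp
  \<comment> \<open>First variation at the minimiser in direction \<open>h\<close>: the defect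
    \<open>b\<close> must vanish. The step length \<open>s * b\<close> with
    \<open>s = 1 / (a + 1)\<close> keeps \<open>s * a < 2\<close>, so a nonzero \<open>b\<close>
    would strictly decrease \<open>\<phi>\<close>; the summand 1 also covers
    \<open>h = 0\<close>.\<close>
  have "f h = inner h z" for h
  proof -
    define a b where "a = inner h h" and "b = inner h z - f h"
    have "a \<ge> 0" by (simp add: a_def)
    define s where "s = 1 / (a + 1)"
    have s: "s > 0" "s * a - 2 < 0"
      using \<open>a \<ge> 0\<close> by (simp_all add: s_def field_simps)
    have "\<phi> (z - t *\<^sub>R h) = \<phi> z + t\<^sup>2 * a - 2 * t * b" for t
      by (simp add: \<phi>_def a_def b_def inner_simps f.diff f.scaleR inner_commute
          power2_eq_square algebra_simps)
    from this[of "s * b"] have "\<phi> (z - (s * b) *\<^sub>R h) = \<phi> z + b\<^sup>2 * (s * (s * a - 2))"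
      by (simp add: power2_eq_square algebra_simps)
    with min[of "z - (s * b) *\<^sub>R h"] have "0 \<le> b\<^sup>2 * (s * (s * a - 2))" by simp
    moreover have "s * (s * a - 2) < 0"
      using s by (rule mult_pos_neg)
    ultimately have "b = 0"
      by (metis mult_pos_neg not_le zero_less_power2)
    then show ?thesis by (simp add: b_def)
  qed
  then show ?thesis by blast
qed

lemma bounded_ops_scaleC:
  "A \<in> bounded_ops \<Longrightarrow> blinfun_apply A (c *\<^sub>C x) = c *\<^sub>C blinfun_apply A x"
  by (simp add: bounded_ops_def)

text \<open>Real Riesz applied to \<open>x \<mapsto> inner (A x) y\<close> gives the value
  \<open>g y\<close>. Complex linearity of \<open>A\<close> upgrades the identity from
  \<open>inner\<close> to \<open>cinner\<close> through \<open>Im_cinner\<close>; linearity of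
  \<open>g\<close> then follows because inner products separate vectors.\<close>

lemma adjoint_exists:
  assumes "A \<in> bounded_ops"
  shows "\<exists>B. \<forall>x y. cinner (blinfun_apply A x) y = cinner x (blinfun_apply B y)"
proof -
  have "bounded_linear (\<lambda>x. inner (blinfun_apply A x) y)" for y
    by (intro bounded_linear_compose[OF bounded_linear_inner_left] blinfun.bounded_linear_right)
  then have "\<exists>z. \<forall>x. inner (blinfun_apply A x) y = inner x z" for y
    by (rule riesz_representation)
  then obtain g where g: "inner (blinfun_apply A x) y = inner x (g y)" for x y
    by metis
  have c: "cinner (blinfun_apply A x) y = cinner x (g y)" for x y
  proof (rule complex_eqI)
    show "Re (cinner (blinfun_apply A x) y) = Re (cinner x (g y))"
      using g by (simp add: inner_eq_Re_cinner)
    show "Im (cinner (blinfun_apply A x) y) = Im (cinner x (g y))"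
      using assms g by (simp add: Im_cinner bounded_ops_scaleC[symmetric])
  qed
  have "bounded_linear g"
  proof (rule bounded_linear_intro[where K = "norm A"])
    show "g (x + y) = g x + g y" for x y
      by (rule cinner_ext_right) (simp add: c[symmetric] cinner_add_right)
    show "g (r *\<^sub>R x) = r *\<^sub>R g x" for r x
      by (rule cinner_ext_right) (simp add: c[symmetric] cinner_scaleC_right flip: scaleC_of_real)
    show "norm (g y) \<le> norm y * norm A" for y
    proof -
      \<comment> \<open>The defining identity at \<open>x = g y\<close>, followed by Cauchy-Schwarz;
        one factor \<open>norm (g y)\<close> cancels.\<close>
      have "norm (g y) * norm (g y) = inner (blinfun_apply A (g y)) y"
        by (simp add: g power2_norm_eq_inner flip: power2_eq_square)
      also have "\<dots> \<le> norm (blinfun_apply A (g y)) * norm y"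
        by (rule norm_cauchy_schwarz)
      also have "\<dots> \<le> norm A * norm (g y) * norm y"
        by (intro mult_right_mono norm_blinfun) simp
      finally have "norm (g y) * norm (g y) \<le> norm (g y) * (norm y * norm A)"
        by (simp add: mult_ac)
      then show ?thesis
        by (cases "norm (g y) = 0") (auto simp: mult_le_cancel_left_pos)
    qed
  qed
  then show ?thesis
    by (intro exI[of _ "Blinfun g"]) (simp add: bounded_linear_Blinfun_apply c)
qed

text \<open>Inner products separate vectors, so at most one operator satisfies the identity. This
  evaluates the definite description in all the adjoint rules below.\<close>

lemma op_adjoint_eqI:
  assumes "\<And>x y. cinner (blinfun_apply A x) y = cinner x (blinfun_apply B y)"
  shows "op_adjoint A = B"
  unfolding op_adjoint_def
proof (rule the_equality)
  fix C
  assume "\<forall>x y. cinner (blinfun_apply A x) y = cinner x (blinfun_apply C y)"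
  then show "C = B"
    using assms by (intro blinfun_eqI cinner_ext_right) metis
qed (use assms in blast)

lemma cinner_op_adjoint:
  assumes "A \<in> bounded_ops"
  shows "cinner (blinfun_apply A x) y = cinner x (blinfun_apply (op_adjoint A) y)"
  using adjoint_exists[OF assms] op_adjoint_eqI by metis

lemma cinner_op_adjoint':
  assumes "A \<in> bounded_ops"
  shows "cinner (blinfun_apply (op_adjoint A) x) y = cinner x (blinfun_apply A y)"
  using cinner_op_adjoint[OF assms] by (metis cinner_commute)

lemma op_adjoint_bounded_ops: "A \<in> bounded_ops \<Longrightarrow> op_adjoint A \<in> bounded_ops"
proof -
  assume A: "A \<in> bounded_ops"
  have "blinfun_apply (op_adjoint A) (c *\<^sub>C x) = c *\<^sub>C blinfun_apply (op_adjoint A) x" for c x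
    by (rule cinner_ext_right) (simp add: cinner_op_adjoint[OF A, symmetric] cinner_scaleC_right)
  then show ?thesis by (simp add: bounded_ops_def)
qed

lemma op_adjoint_op_adjoint: "A \<in> bounded_ops \<Longrightarrow> op_adjoint (op_adjoint A) = A"
  by (rule op_adjoint_eqI) (rule cinner_op_adjoint')

lemma op_adjoint_compose:
  "A \<in> bounded_ops \<Longrightarrow> B \<in> bounded_ops \<Longrightarrow>
    op_adjoint (A o\<^sub>L B) = op_adjoint B o\<^sub>L op_adjoint A"
  by (rule op_adjoint_eqI) (simp add: cinner_op_adjoint)

lemma op_adjoint_add:
  "A \<in> bounded_ops \<Longrightarrow> B \<in> bounded_ops \<Longrightarrow>
    op_adjoint (A + B) = op_adjoint A + op_adjoint B"
  by (rule op_adjoint_eqI)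
    (simp add: cinner_op_adjoint cinner_add_left cinner_add_right blinfun.add_left)

lemma op_adjoint_scaleC:
  "A \<in> bounded_ops \<Longrightarrow> op_adjoint (op_scaleC c A) = op_scaleC (cnj c) (op_adjoint A)"
  by (rule op_adjoint_eqI)
    (simp add: op_scaleC_apply cinner_op_adjoint cinner_scaleC_left cinner_scaleC_right)

lemma op_adjoint_zero: "op_adjoint 0 = 0"
  by (rule op_adjoint_eqI) (simp add: cinner_zero_left cinner_zero_right)

lemma op_adjoint_id: "op_adjoint id_blinfun = id_blinfun"
  by (rule op_adjoint_eqI) simp

section \<open>Unital subalgebras\<close>

text \<open>Lets the closure rules for subalgebras serve for membership in
  \<open>bounded_ops\<close> as well.\<close>

lemma unital_subalgebra_bounded_ops: "unital_subalgebra bounded_ops"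
  by (auto simp: unital_subalgebra_def bounded_ops_def op_scaleC_apply blinfun.add_left
      scaleC_add_right scaleC_scaleC mult.commute)

lemma
  assumes "unital_subalgebra \<AA>"
  shows unital_subalgebra_bounded: "\<AA> \<subseteq> bounded_ops"
    and unital_subalgebra_id: "id_blinfun \<in> \<AA>"
    and unital_subalgebra_add: "A \<in> \<AA> \<Longrightarrow> B \<in> \<AA> \<Longrightarrow> A + B \<in> \<AA>"
    and unital_subalgebra_scaleC: "A \<in> \<AA> \<Longrightarrow> op_scaleC c A \<in> \<AA>"
    and unital_subalgebra_compose: "A \<in> \<AA> \<Longrightarrow> B \<in> \<AA> \<Longrightarrow> A o\<^sub>L B \<in> \<AA>"
  using assms by (simp_all add: unital_subalgebra_def)

lemma op_scaleC_of_real: "op_scaleC (complex_of_real r) A = r *\<^sub>R A"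
  by (rule blinfun_eqI) (simp add: op_scaleC_apply scaleC_of_real blinfun.scaleR_left)

lemma unital_subalgebra_scaleR:
  "unital_subalgebra \<AA> \<Longrightarrow> A \<in> \<AA> \<Longrightarrow> r *\<^sub>R A \<in> \<AA>"
  by (metis op_scaleC_of_real unital_subalgebra_scaleC)

lemma unital_subalgebra_zero: "unital_subalgebra \<AA> \<Longrightarrow> 0 \<in> \<AA>"
  using unital_subalgebra_scaleR[of \<AA> id_blinfun 0] unital_subalgebra_id[of \<AA>] by simp

lemma unital_subalgebra_diff:
  "unital_subalgebra \<AA> \<Longrightarrow> A \<in> \<AA> \<Longrightarrow> B \<in> \<AA> \<Longrightarrow> A - B \<in> \<AA>"
  using unital_subalgebra_add[of \<AA> A "(-1) *\<^sub>R B"] unital_subalgebra_scaleR[of \<AA> B "-1"]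
  by simp

lemma unital_subalgebra_sum:
  "unital_subalgebra \<AA> \<Longrightarrow> (\<And>i. i \<in> I \<Longrightarrow> f i \<in> \<AA>) \<Longrightarrow> sum f I \<in> \<AA>"
  by (induction I rule: infinite_finite_induct)
    (auto intro: unital_subalgebra_zero unital_subalgebra_add)

lemma word_op_in_subalgebra:
  assumes "unital_subalgebra \<AA>" "R ` I \<subseteq> \<AA>" "xs \<in> lists I"
  shows "word_op R xs \<in> \<AA>"
  using assms(3)
  by (induction xs)
    (use assms(1,2) in \<open>auto simp: word_op_simps intro: unital_subalgebra_id unital_subalgebra_compose\<close>)

section \<open>The weak operator topology\<close>

lemma topspace_wot: "topspace wot = bounded_ops"
  by (simp add: wot_def topspace_pullback_topology)

lemma continuous_map_wot_cinner:
  "continuous_map wot euclidean (\<lambda>A. cinner (blinfun_apply A x) y)"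
proof -
  have "continuous_map euclidean euclidean (\<lambda>f :: 'a \<times> 'a \<Rightarrow> complex. f (x, y))"
    by (simp add: continuous_on_product_then_coordinatewise)
  from continuous_map_pullback[OF this, of bounded_ops "\<lambda>A (x, y). cinner (blinfun_apply A x) y"]
  show ?thesis
    by (simp add: wot_def o_def)
qed

text \<open>The universal property of the initial topology: continuity into the product of copies of
  the complex numbers is componentwise.\<close>

lemma continuous_map_into_wotI:
  assumes "\<And>A. A \<in> topspace X \<Longrightarrow> f A \<in> bounded_ops"
    and "\<And>x y. continuous_map X euclidean (\<lambda>A. cinner (blinfun_apply (f A) x) y)"
  shows "continuous_map X wot f"
  unfolding wot_def
proof (rule continuous_map_pullback')
  show "continuous_map X euclidean ((\<lambda>A (x, y). cinner (blinfun_apply A x) y) \<circ> f)"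
    unfolding euclidean_product_topology[symmetric] continuous_map_componentwise_UNIV
    using assms(2) by auto
  show "topspace X \<subseteq> f -` bounded_ops" using assms(1) by auto
qed

text \<open>Moving \<open>B\<close> to the other side as its adjoint turns a coefficient of
  \<open>B o\<^sub>L A\<close> into a coefficient of \<open>A\<close>.\<close>

lemma continuous_map_wot_compose_left:
  assumes "B \<in> bounded_ops"
  shows "continuous_map wot wot (\<lambda>A. B o\<^sub>L A)"
proof (rule continuous_map_into_wotI)
  show "continuous_map wot euclidean (\<lambda>A. cinner (blinfun_apply (B o\<^sub>L A) x) y)" for x y
    using assms continuous_map_wot_cinner by (simp add: cinner_op_adjoint)
qed (use assms unital_subalgebra_compose[OF unital_subalgebra_bounded_ops] in
    \<open>simp add: topspace_wot\<close>)

lemma continuous_map_wot_compose_right: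
  assumes "B \<in> bounded_ops"
  shows "continuous_map wot wot (\<lambda>A. A o\<^sub>L B)"
proof (rule continuous_map_into_wotI)
  show "continuous_map wot euclidean (\<lambda>A. cinner (blinfun_apply (A o\<^sub>L B) x) y)" for x y
    using continuous_map_wot_cinner by simp
qed (use assms unital_subalgebra_compose[OF unital_subalgebra_bounded_ops] in
    \<open>simp add: topspace_wot\<close>)

text \<open>A coefficient of the adjoint is the conjugate of the coefficient of \<open>A\<close>
  with the two vectors swapped.\<close>

lemma continuous_map_wot_op_adjoint: "continuous_map wot wot op_adjoint"
proof (rule continuous_map_into_wotI)
  fix x y :: 'a
  have "continuous_map wot euclidean (\<lambda>A. cnj (cinner (blinfun_apply A y) x))"
    by (rule continuous_map_compose[OF continuous_map_wot_cinner, unfolded o_def])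
      (auto intro: continuous_intros)
  then show "continuous_map wot euclidean (\<lambda>A. cinner (blinfun_apply (op_adjoint A) x) y)"
    by (rule continuous_map_eq) (metis cinner_op_adjoint' cinner_commute topspace_wot)
qed (simp add: topspace_wot op_adjoint_bounded_ops)

text \<open>Equality is tested on each coefficient, and each test is the preimage of the closed set
  \<open>{0}\<close>. Operator identities in \<open>A\<close> thereby become WOT-closed
  conditions.\<close>

lemma closedin_wot_equalizer:
  assumes "continuous_map wot wot f" "continuous_map wot wot g"
  shows "closedin wot {A \<in> bounded_ops. f A = g A}"
proof -
  let ?E = "\<lambda>x y. {A \<in> topspace wot.
    cinner (blinfun_apply (f A) x) y - cinner (blinfun_apply (g A) x) y \<in> {0}}"
  have "continuous_map wot euclidean
      (\<lambda>A. cinner (blinfun_apply (f A) x) y - cinner (blinfun_apply (g A) x) y)" for x y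
    using continuous_map_compose[OF assms(1) continuous_map_wot_cinner[of x y]]
      continuous_map_compose[OF assms(2) continuous_map_wot_cinner[of x y]]
    by (auto intro: continuous_map_diff simp: o_def)
  then have "closedin wot (?E x y)" for x y
    by (rule closedin_continuous_map_preimage) simp
  then have "closedin wot (\<Inter>x. \<Inter>y. ?E x y)"
    by (intro closedin_Inter) auto
  moreover have "(\<Inter>x. \<Inter>y. ?E x y) = {A \<in> bounded_ops. f A = g A}"
  proof (intro equalityI subsetI)
    fix A
    assume A: "A \<in> (\<Inter>x. \<Inter>y. ?E x y)"
    then have "cinner (blinfun_apply (f A) x) y = cinner (blinfun_apply (g A) x) y" for x y
    proof -
      have "A \<in> ?E x y" using A by blast
      then show ?thesis by simp
    qed
    then have "f A = g A"
      by (rule blinfun_eqI[OF cinner_ext_left])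
    moreover have "A \<in> bounded_ops"
      using A unfolding topspace_wot by blast
    ultimately show "A \<in> {A \<in> bounded_ops. f A = g A}" by simp
  qed (simp add: topspace_wot)
  ultimately show ?thesis by simp
qed

section \<open>Generated WOT-closed algebras and self-adjointness\<close>

lemma
  assumes "X \<subseteq> bounded_ops"
  shows unital_subalgebra_generated: "unital_subalgebra (wot_algebra_generated X)"
    and closedin_wot_generated: "closedin wot (wot_algebra_generated X)"
proof -
  have *: "closedin wot bounded_ops" by (metis closedin_topspace topspace_wot)
  \<comment> \<open>The intersected family must be nonempty; \<open>bounded_ops\<close> itself is a
    member.\<close>
  have "{\<AA>. unital_subalgebra \<AA> \<and> closedin wot \<AA> \<and> X \<subseteq> \<AA>} \<noteq> {}"
    using unital_subalgebra_bounded_ops * assms by blast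
  then show "closedin wot (wot_algebra_generated X)"
    unfolding wot_algebra_generated_def by (rule closedin_Inter) blast
  have "wot_algebra_generated X \<subseteq> bounded_ops"
    using unital_subalgebra_bounded_ops * assms unfolding wot_algebra_generated_def by blast
  then show "unital_subalgebra (wot_algebra_generated X)"
    unfolding wot_algebra_generated_def by (auto simp: unital_subalgebra_def)
qed

lemma generators_subset: "X \<subseteq> wot_algebra_generated X"
  unfolding wot_algebra_generated_def by blast

lemma wot_algebra_generated_least:
  "unital_subalgebra \<AA> \<Longrightarrow> closedin wot \<AA> \<Longrightarrow> X \<subseteq> \<AA> \<Longrightarrow> wot_algebra_generated X \<subseteq> \<AA>"
  unfolding wot_algebra_generated_def by blast

text \<open>The elements whose adjoint stays in the algebra form a unital subalgebra containing
  \<open>X\<close>. It is WOT-closed by continuity of the adjoint, hence it is everything.\<close>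

lemma von_neumann_algebra_generatedI:
  assumes "X \<subseteq> bounded_ops" and "op_adjoint ` X \<subseteq> wot_algebra_generated X"
  shows "von_neumann_algebra (wot_algebra_generated X)"
proof -
  let ?\<AA> = "wot_algebra_generated X"
  let ?\<BB> = "{A \<in> ?\<AA>. op_adjoint A \<in> ?\<AA>}"
  note sub = unital_subalgebra_generated[OF assms(1)]
  note closed = closedin_wot_generated[OF assms(1)]
  have bd: "A \<in> bounded_ops" if "A \<in> ?\<AA>" for A
    using that unital_subalgebra_bounded[OF sub] by blast
  have "unital_subalgebra ?\<BB>"
    using sub unfolding unital_subalgebra_def[of ?\<BB>]
    by (auto simp: bd op_adjoint_id op_adjoint_add op_adjoint_scaleC op_adjoint_compose
        intro: unital_subalgebra_id unital_subalgebra_add unital_subalgebra_scaleC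
          unital_subalgebra_compose)
  moreover have "closedin wot ?\<BB>"
    by (rule closedin_continuous_map_preimage_gen[OF continuous_map_wot_op_adjoint closed closed])
  moreover have "X \<subseteq> ?\<BB>"
    using assms(2) generators_subset by blast
  ultimately have "?\<AA> \<subseteq> ?\<BB>" by (rule wot_algebra_generated_least)
  then show ?thesis
    using sub closed by (auto simp: von_neumann_algebra_def)
qed

section \<open>Row isometries\<close>

text \<open>The row operator on a direct sum is replaced by its entries; the last condition says
  entrywise that the row times its adjoint, in the order adjoint first, is the identity.\<close>

definition row_isometry ::
  "'i set \<Rightarrow> ('i \<Rightarrow> 'h::complex_hilbert_space \<Rightarrow>\<^sub>L 'h) \<Rightarrow> bool" where
  "row_isometry I R \<longleftrightarrow> finite I \<and> R ` I \<subseteq> bounded_ops \<and>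
    (\<forall>i\<in>I. \<forall>j\<in>I. op_adjoint (R i) o\<^sub>L R j = (if i = j then id_blinfun else 0))"

text \<open>For a row isometry this is the row times its adjoint, the orthogonal projection onto the
  range of the row.\<close>

definition range_proj ::
  "'i set \<Rightarrow> ('i \<Rightarrow> 'h::complex_hilbert_space \<Rightarrow>\<^sub>L 'h) \<Rightarrow> 'h \<Rightarrow>\<^sub>L 'h" where
  "range_proj I R = (\<Sum>i\<in>I. R i o\<^sub>L op_adjoint (R i))"

lemma range_proj_apply:
  "blinfun_apply (range_proj I R) x = (\<Sum>i\<in>I. blinfun_apply (R i) (blinfun_apply (op_adjoint (R i)) x))"
  by (simp add: range_proj_def blinfun.sum_left)

lemma row_isometry_bounded: "row_isometry I R \<Longrightarrow> i \<in> I \<Longrightarrow> R i \<in> bounded_ops"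
  by (auto simp: row_isometry_def)

lemma row_isometry_apply:
  assumes "row_isometry I R" "i \<in> I" "j \<in> I"
  shows "blinfun_apply (op_adjoint (R i)) (blinfun_apply (R j) x) = (if i = j then x else 0)"
proof -
  have "blinfun_apply (op_adjoint (R i) o\<^sub>L R j) x = (if i = j then x else 0)"
    using assms by (simp add: row_isometry_def del: blinfun_apply_blinfun_compose)
  then show ?thesis by simp
qed

lemma range_proj_bounded_ops: "row_isometry I R \<Longrightarrow> range_proj I R \<in> bounded_ops"
  unfolding range_proj_def
  by (intro unital_subalgebra_sum[OF unital_subalgebra_bounded_ops]
      unital_subalgebra_compose[OF unital_subalgebra_bounded_ops] op_adjoint_bounded_ops
      row_isometry_bounded)

lemma range_proj_row:
  assumes "row_isometry I R" "j \<in> I"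
  shows "range_proj I R o\<^sub>L R j = R j"
proof (rule blinfun_eqI)
  fix x
  have "(\<Sum>i\<in>I. blinfun_apply (R i) (blinfun_apply (op_adjoint (R i)) (blinfun_apply (R j) x))) =
      (\<Sum>i\<in>I. if i = j then blinfun_apply (R j) x else 0)"
    using assms by (intro sum.cong) (auto simp: row_isometry_apply blinfun.zero_right)
  also have "\<dots> = blinfun_apply (R j) x"
    using assms by (simp add: row_isometry_def)
  finally show "blinfun_apply (range_proj I R o\<^sub>L R j) x = blinfun_apply (R j) x"
    by (simp add: range_proj_apply)
qed

lemma range_proj_idem:
  assumes "row_isometry I R"
  shows "range_proj I R o\<^sub>L range_proj I R = range_proj I R"
proof (rule blinfun_eqI)
  fix x
  have "blinfun_apply (range_proj I R) (blinfun_apply (R i) y) = blinfun_apply (R i) y"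
    if "i \<in> I" for i y
    using range_proj_row[OF assms that] by (metis blinfun_apply_blinfun_compose)
  then show "blinfun_apply (range_proj I R o\<^sub>L range_proj I R) x = blinfun_apply (range_proj I R) x"
    by (simp add: range_proj_apply[of I R x] blinfun.sum_right)
qed

lemma op_adjoint_range_proj:
  assumes "row_isometry I R"
  shows "op_adjoint (range_proj I R) = range_proj I R"
proof -
  \<comment> \<open>The induction runs over subsets \<open>J\<close>, so that the row isometry on
    \<open>I\<close> stays available.\<close>
  have "op_adjoint (\<Sum>i\<in>J. R i o\<^sub>L op_adjoint (R i)) = (\<Sum>i\<in>J. R i o\<^sub>L op_adjoint (R i))"
    if "finite J" "J \<subseteq> I" for J
    using that
  proof induction
    case empty
    show ?case by (simp add: op_adjoint_zero)
  next
    case (insert i J)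
    have b: "R j \<in> bounded_ops" "op_adjoint (R j) \<in> bounded_ops"
        "R j o\<^sub>L op_adjoint (R j) \<in> bounded_ops" if "j \<in> I" for j
      using that assms
      by (auto intro: row_isometry_bounded op_adjoint_bounded_ops
          unital_subalgebra_compose[OF unital_subalgebra_bounded_ops])
    moreover have "(\<Sum>i\<in>J. R i o\<^sub>L op_adjoint (R i)) \<in> bounded_ops"
      using b insert.prems by (intro unital_subalgebra_sum[OF unital_subalgebra_bounded_ops]) auto
    ultimately show ?case
      using insert by (simp add: op_adjoint_add op_adjoint_compose op_adjoint_op_adjoint)
  qed
  then show ?thesis
    using assms by (simp add: range_proj_def row_isometry_def)
qed

text \<open>By the exchange property the generators, and hence the whole algebra, leave the range of
  the row invariant. Self-adjointness puts \<open>op_adjoint (R i)\<close> into the algebra, and it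
  maps the range of \<open>R i\<close> onto the whole space, so the complementary projection
  \<open>Q\<close> is zero.\<close>

lemma range_proj_eq_id:
  assumes "row_isometry I R" "I \<noteq> {}" "X \<subseteq> bounded_ops"
    and vN: "von_neumann_algebra (wot_algebra_generated X)"
    and R: "R ` I \<subseteq> wot_algebra_generated X"
    and exch: "\<And>A i. A \<in> X \<Longrightarrow> i \<in> I \<Longrightarrow> \<exists>j\<in>I. \<exists>B. A o\<^sub>L R i = R j o\<^sub>L B"
  shows "range_proj I R = id_blinfun"
proof -
  define Q where "Q = id_blinfun - range_proj I R"
  have Qb: "Q \<in> bounded_ops"
    unfolding Q_def using assms(1) unital_subalgebra_bounded_ops
    by (intro unital_subalgebra_diff unital_subalgebra_id range_proj_bounded_ops)
  have PP: "blinfun_apply (range_proj I R) (blinfun_apply (range_proj I R) x) =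
      blinfun_apply (range_proj I R) x" for x
    using range_proj_idem[OF assms(1)] by (metis blinfun_apply_blinfun_compose)
  have QQ: "Q o\<^sub>L Q = Q"
    by (rule blinfun_eqI) (simp add: Q_def blinfun.diff_left blinfun.diff_right PP)
  have QR: "blinfun_apply Q (blinfun_apply (R i) x) = 0" if "i \<in> I" for i x
    using range_proj_row[OF assms(1) that]
    by (simp add: Q_def blinfun.diff_left) (metis blinfun_apply_blinfun_compose)
  have Qadj: "op_adjoint Q = Q"
  proof (rule op_adjoint_eqI)
    fix x y
    have "cinner (blinfun_apply (range_proj I R) x) y = cinner x (blinfun_apply (range_proj I R) y)"
      using cinner_op_adjoint[OF range_proj_bounded_ops[OF assms(1)]]
      by (simp add: op_adjoint_range_proj[OF assms(1)])
    then show "cinner (blinfun_apply Q x) y = cinner x (blinfun_apply Q y)"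
      by (simp add: Q_def blinfun.diff_left cinner_diff_left cinner_diff_right)
  qed
  \<comment> \<open>The operators that leave the kernel of \<open>Q\<close>, the range of the row,
    invariant. Stating this as an equation in \<open>A\<close> makes the set WOT-closed by
    \<open>closedin_wot_equalizer\<close>.\<close>
  let ?\<BB> = "{A \<in> bounded_ops. Q o\<^sub>L A = Q o\<^sub>L (A o\<^sub>L Q)}"
  have B_iff: "A \<in> ?\<BB> \<longleftrightarrow> A \<in> bounded_ops \<and>
      (\<forall>x. blinfun_apply Q (blinfun_apply A (blinfun_apply Q x)) = blinfun_apply Q (blinfun_apply A x))" for A
    by (auto intro!: blinfun_eqI dest: arg_cong[where f = blinfun_apply] simp: fun_eq_iff)
  have "unital_subalgebra ?\<BB>"
    unfolding unital_subalgebra_def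
  proof (intro conjI ballI allI)
    have *: "blinfun_apply Q (blinfun_apply Q x) = blinfun_apply Q x" for x
      using QQ by (metis blinfun_apply_blinfun_compose)
    note bd = unital_subalgebra_bounded_ops
    show "id_blinfun \<in> ?\<BB>"
      unfolding B_iff by (simp add: * unital_subalgebra_id[OF bd])
    fix A B c
    assume A: "A \<in> ?\<BB>"
    show "op_scaleC c A \<in> ?\<BB>"
      using A unfolding B_iff
      by (simp add: unital_subalgebra_scaleC[OF bd] op_scaleC_apply bounded_ops_scaleC[OF Qb])
    assume B: "B \<in> ?\<BB>"
    show "A + B \<in> ?\<BB>"
      using A B unfolding B_iff
      by (simp add: unital_subalgebra_add[OF bd] blinfun.add_left blinfun.add_right)
    \<comment> \<open>A factor \<open>Q\<close> may be inserted between \<open>A\<close> and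
      \<open>B\<close>, which lets the condition on \<open>B\<close> remove the \<open>Q\<close> on
      the right.\<close>
    show "A o\<^sub>L B \<in> ?\<BB>"
      using A B unfolding B_iff by (metis unital_subalgebra_compose[OF bd] blinfun_apply_blinfun_compose)
  qed auto
  moreover have "closedin wot ?\<BB>"
    using continuous_map_compose[OF continuous_map_wot_compose_right[OF Qb]
        continuous_map_wot_compose_left[OF Qb]]
    by (intro closedin_wot_equalizer continuous_map_wot_compose_left Qb) (simp add: o_def)
  moreover have "X \<subseteq> ?\<BB>"
  proof
    fix A
    assume A: "A \<in> X"
    have "blinfun_apply Q (blinfun_apply A (blinfun_apply (R i) y)) = 0" if i: "i \<in> I" for i y
    proof -
      obtain j B where "j \<in> I" "A o\<^sub>L R i = R j o\<^sub>L B"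
        using exch[OF A i] by blast
      then show ?thesis
        using QR by (metis blinfun_apply_blinfun_compose)
    qed
    then have "blinfun_apply Q (blinfun_apply A (blinfun_apply (range_proj I R) x)) = 0" for x
      by (simp add: range_proj_apply blinfun.sum_right)
    moreover have "blinfun_apply Q x = x - blinfun_apply (range_proj I R) x" for x
      by (simp add: Q_def blinfun.diff_left)
    ultimately have "blinfun_apply Q (blinfun_apply A (blinfun_apply Q x)) =
        blinfun_apply Q (blinfun_apply A x)" for x
      by (metis blinfun.diff_right diff_zero)
    then show "A \<in> ?\<BB>"
      using A assms(3) unfolding B_iff by auto
  qed
  ultimately have sub: "wot_algebra_generated X \<subseteq> ?\<BB>"
    by (rule wot_algebra_generated_least)
  obtain i where i: "i \<in> I" using assms(2) by blast
  have "op_adjoint (R i) \<in> ?\<BB>"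
    using vN R i sub by (auto simp: von_neumann_algebra_def)
  then have adj: "blinfun_apply Q (blinfun_apply (op_adjoint (R i)) (blinfun_apply Q x)) =
      blinfun_apply Q (blinfun_apply (op_adjoint (R i)) x)" for x
    unfolding B_iff by blast
  have "blinfun_apply Q x = 0" for x
  proof -
    \<comment> \<open>Every \<open>x\<close> is the image under \<open>op_adjoint (R i)\<close> of
      \<open>R i x\<close>, a vector that \<open>Q\<close> kills.\<close>
    have "blinfun_apply Q x = blinfun_apply Q (blinfun_apply (op_adjoint (R i)) (blinfun_apply (R i) x))"
      using row_isometry_apply[OF assms(1) i i] by simp
    also have "\<dots> = 0"
      using adj[of "blinfun_apply (R i) x"] QR[OF i] by (simp add: blinfun.zero_right)
    finally show ?thesis .
  qed
  then have "Q = 0" by (intro blinfun_eqI) simp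
  then show ?thesis by (simp add: Q_def)
qed

text \<open>
  The right ideal generated by a row isometry \<open>R\<close> consists of the sums \<open>\<Sum>\<^sub>i R\<^sub>i A\<^sub>i\<close>, where
  \<open>A\<^sub>i = R\<^sub>i\<^sup>* A\<close> lies in the algebra; this condition on \<open>A\<close> is WOT-closed.
\<close>

lemma id_in_row_ideal_iff:
  assumes row: "row_isometry I R" and sub: "unital_subalgebra \<AA>" and closed: "closedin wot \<AA>"
    and R: "R ` I \<subseteq> \<AA>"
  shows "id_blinfun \<in> wot_right_ideal_generated \<AA> (R ` I) \<longleftrightarrow>
    (\<forall>i\<in>I. op_adjoint (R i) \<in> \<AA>) \<and> range_proj I R = id_blinfun"
proof
  let ?P = "range_proj I R"
  let ?E = "{A \<in> bounded_ops. ?P o\<^sub>L A = A}"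
  let ?F = "\<lambda>i. {A \<in> \<AA>. op_adjoint (R i) o\<^sub>L A \<in> \<AA>}"
  let ?\<JJ> = "?E \<inter> \<AA> \<inter> (\<Inter>i\<in>I. ?F i)"
  have assoc: "A o\<^sub>L (B o\<^sub>L C) = (A o\<^sub>L B) o\<^sub>L C" for A B C :: "'b \<Rightarrow>\<^sub>L 'b"
    by (rule blinfun_eqI) simp
  have distrib: "A o\<^sub>L (B + C) = (A o\<^sub>L B) + (A o\<^sub>L C)" for A B C :: "'b \<Rightarrow>\<^sub>L 'b"
    by (rule blinfun_eqI) (simp add: blinfun.add_left blinfun.add_right)
  have Rb: "op_adjoint (R i) \<in> bounded_ops" if "i \<in> I" for i
    using row that by (intro op_adjoint_bounded_ops row_isometry_bounded)
  note bd = unital_subalgebra_bounded[OF sub, THEN subsetD]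
  have "closedin wot ?E"
    by (intro closedin_wot_equalizer continuous_map_wot_compose_left range_proj_bounded_ops row)
      (use continuous_map_id in \<open>simp add: id_def\<close>)
  moreover have "closedin wot (?F i)" if "i \<in> I" for i
    using closedin_continuous_map_preimage_gen[OF continuous_map_wot_compose_left[OF Rb[OF that]]
        closed closed] .
  ultimately have "closedin wot ?\<JJ>"
    \<comment> \<open>For empty \<open>I\<close> the last intersection is \<open>UNIV\<close>, so
      the rule for intersections of nonempty families of closed sets does not apply.\<close>
    using closed by (cases "I = {}") (auto intro!: closedin_Int closedin_Inter)
  moreover have "right_ideal \<AA> ?\<JJ>"
    unfolding right_ideal_def
    by (auto simp: bd assoc distrib unital_subalgebra_zero[OF sub] unital_subalgebra_add[OF sub]
        unital_subalgebra_compose[OF sub])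
  \<comment> \<open>The products \<open>op_adjoint (R i) o\<^sub>L R j\<close> are the identity or
    zero, both in \<open>\<AA>\<close>.\<close>
  moreover have "R ` I \<subseteq> ?\<JJ>"
    using R row unital_subalgebra_id[OF sub] unital_subalgebra_zero[OF sub]
    by (auto simp: bd range_proj_row row_isometry_def)
  ultimately have "wot_right_ideal_generated \<AA> (R ` I) \<subseteq> ?\<JJ>"
    unfolding wot_right_ideal_generated_def by blast
  moreover have "A o\<^sub>L id_blinfun = A" for A :: "'b \<Rightarrow>\<^sub>L 'b"
    by (rule blinfun_eqI) simp
  moreover assume "id_blinfun \<in> wot_right_ideal_generated \<AA> (R ` I)"
  ultimately show "(\<forall>i\<in>I. op_adjoint (R i) \<in> \<AA>) \<and> ?P = id_blinfun"
    by auto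
next
  assume *: "(\<forall>i\<in>I. op_adjoint (R i) \<in> \<AA>) \<and> range_proj I R = id_blinfun"
  \<comment> \<open>Any right ideal containing \<open>R i\<close> absorbs the factor
    \<open>op_adjoint (R i)\<close> on the right, since that factor lies in
    \<open>\<AA>\<close>.\<close>
  have "range_proj I R \<in> \<JJ>" if J: "right_ideal \<AA> \<JJ>" "R ` I \<subseteq> \<JJ>" for \<JJ>
  proof -
    have "(\<Sum>i\<in>K. R i o\<^sub>L op_adjoint (R i)) \<in> \<JJ>" if "K \<subseteq> I" for K
      using that
      by (induction K rule: infinite_finite_induct) (use J * in \<open>auto simp: right_ideal_def\<close>)
    then show ?thesis by (simp add: range_proj_def)
  qed
  then show "id_blinfun \<in> wot_right_ideal_generated \<AA> (R ` I)"
    using * unfolding wot_right_ideal_generated_def by auto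
qed

section \<open>Words in an isometric representation\<close>

lemma word_op_Cons_apply:
  "blinfun_apply (word_op R (i # u)) x = blinfun_apply (R i) (blinfun_apply (word_op R u) x)"
  by (simp add: word_op_simps)

lemma word_op_bounded_ops:
  "row_isometry I R \<Longrightarrow> u \<in> lists I \<Longrightarrow> word_op R u \<in> bounded_ops"
  by (rule word_op_in_subalgebra[OF unital_subalgebra_bounded_ops]) (auto simp: row_isometry_def)

text \<open>Matching first letters cancel in turn and the first mismatch gives zero. Equal lengths
  exclude a proper prefix, which would leave an uncancelled word.\<close>

lemma op_adjoint_word_op_apply:
  assumes "row_isometry I R" "length u = length v" "u \<in> lists I" "v \<in> lists I"
  shows "blinfun_apply (op_adjoint (word_op R u)) (blinfun_apply (word_op R v) x) =
    (if u = v then x else 0)"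
  using assms(2-4)
proof (induction u v rule: list_induct2)
  case Nil
  then show ?case by (simp add: word_op_simps op_adjoint_id)
next
  case (Cons i u j v)
  have "op_adjoint (word_op R (i # u)) = op_adjoint (word_op R u) o\<^sub>L op_adjoint (R i)"
    using Cons.prems assms(1)
    by (simp add: word_op_simps op_adjoint_compose row_isometry_bounded word_op_bounded_ops)
  then show ?case
    using Cons row_isometry_apply[OF assms(1)]
    by (cases "u = v"; cases "i = j") (simp_all add: word_op_Cons_apply blinfun.zero_right)
qed

text \<open>\<open>A\<close> is passed through the word letter by letter and may change inside the
  class \<open>C\<close> at each step. The length is recorded because it determines the
  degree.\<close>

lemma exchange_word_right:
  assumes "\<And>A i. A \<in> C \<Longrightarrow> i \<in> I \<Longrightarrow> \<exists>j\<in>I. \<exists>B\<in>C. A o\<^sub>L R i = R j o\<^sub>L B"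
    and "A \<in> C" "u \<in> lists I"
  shows "\<exists>v\<in>lists I. length v = length u \<and> (\<exists>B\<in>C. A o\<^sub>L word_op R u = word_op R v o\<^sub>L B)"
  using assms(3,2)
proof (induction u arbitrary: A)
  case Nil
  then show ?case
    by (intro bexI[of _ "[]"] conjI bexI[of _ A]) (auto simp: word_op_simps intro: blinfun_eqI)
next
  case (Cons i u)
  obtain j B where j: "j \<in> I" "B \<in> C" "A o\<^sub>L R i = R j o\<^sub>L B"
    using assms(1) Cons.prems Cons.hyps by blast
  obtain v D where v: "v \<in> lists I" "length v = length u" "D \<in> C"
      "B o\<^sub>L word_op R u = word_op R v o\<^sub>L D"
    using Cons.IH[OF j(2)] by blast
  have "A o\<^sub>L word_op R (i # u) = (A o\<^sub>L R i) o\<^sub>L word_op R u"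
    by (rule blinfun_eqI) (simp add: word_op_simps)
  also have "\<dots> = R j o\<^sub>L (B o\<^sub>L word_op R u)"
    by (rule blinfun_eqI) (simp add: j)
  also have "\<dots> = word_op R (j # v) o\<^sub>L D"
    by (rule blinfun_eqI) (simp add: v word_op_simps)
  finally show ?case
    using j v by (intro bexI[of _ "j # v"]) auto
qed

text \<open>The mirror image: the tail of the word passes \<open>A\<close> first, so the induction
  keeps \<open>A\<close> fixed and its head meets the operator \<open>D\<close> obtained from the
  tail.\<close>

lemma exchange_word_left:
  assumes "\<And>A i. A \<in> C \<Longrightarrow> i \<in> I \<Longrightarrow> \<exists>j\<in>I. \<exists>B\<in>C. R i o\<^sub>L A = B o\<^sub>L R j"
    and "A \<in> C" "u \<in> lists I"
  shows "\<exists>v\<in>lists I. \<exists>B\<in>C. word_op R u o\<^sub>L A = B o\<^sub>L word_op R v"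
  using assms(3)
proof induction
  case Nil
  then show ?case
    using assms(2)
    by (intro bexI[of _ "[]"] bexI[of _ A]) (auto simp: word_op_simps intro: blinfun_eqI)
next
  case (Cons i u)
  obtain v D where v: "v \<in> lists I" "D \<in> C" "word_op R u o\<^sub>L A = D o\<^sub>L word_op R v"
    using Cons.IH by blast
  obtain j B where j: "j \<in> I" "B \<in> C" "R i o\<^sub>L D = B o\<^sub>L R j"
    using assms(1) v Cons.hyps by blast
  have "word_op R (i # u) o\<^sub>L A = R i o\<^sub>L (word_op R u o\<^sub>L A)"
    by (rule blinfun_eqI) (simp add: word_op_simps)
  also have "\<dots> = (R i o\<^sub>L D) o\<^sub>L word_op R v"
    by (rule blinfun_eqI) (simp add: v)
  also have "\<dots> = B o\<^sub>L word_op R (j # v)"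
    by (rule blinfun_eqI) (simp add: j word_op_simps)
  finally show ?case
    using j v by (intro bexI[of _ "j # v"]) auto
qed

section \<open>Words of fixed degree and the generators\<close>

context
  fixes m n \<theta> and S T :: "nat \<Rightarrow> 'h::complex_hilbert_space \<Rightarrow>\<^sub>L 'h"
  assumes data: "two_graph_data m n \<theta>" and rep: "isometric_representation m n \<theta> S T"
begin

lemma row_isometry_S: "row_isometry {1..m} S" and row_isometry_T: "row_isometry {1..n} T"
  using rep by (auto simp: isometric_representation_def row_isometry_def)

lemma S_T_exchange:
  assumes "i \<in> {1..m}" "j \<in> {1..n}"
  shows "\<exists>j'\<in>{1..n}. \<exists>i'\<in>{1..m}. S i o\<^sub>L T j = T j' o\<^sub>L S i'"
proof -
  obtain i' j' where ij: "\<theta> (i, j) = (i', j')" by fastforce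
  have "\<theta> ` ({1..m} \<times> {1..n}) = {1..m} \<times> {1..n}"
    using data by (simp add: two_graph_data_def bij_betw_def)
  then have "\<theta> (i, j) \<in> {1..m} \<times> {1..n}"
    using assms by blast
  then have "j' \<in> {1..n}" "i' \<in> {1..m}"
    by (simp_all add: ij)
  moreover have "S i o\<^sub>L T j = T j' o\<^sub>L S i'"
    using rep assms ij unfolding isometric_representation_def by blast
  ultimately show ?thesis by blast
qed

text \<open>Reading the commutation relation backwards rests on surjectivity of
  \<open>\<theta>\<close>.\<close>

lemma T_S_exchange:
  assumes "i \<in> {1..m}" "j \<in> {1..n}"
  shows "\<exists>i'\<in>{1..m}. \<exists>j'\<in>{1..n}. T j o\<^sub>L S i = S i' o\<^sub>L T j'"
proof -
  have "(i, j) \<in> \<theta> ` ({1..m} \<times> {1..n})"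
    using data assms by (simp add: two_graph_data_def bij_betw_def)
  then obtain i' j' where "i' \<in> {1..m}" "j' \<in> {1..n}" "\<theta> (i', j') = (i, j)"
    by force
  then show ?thesis
    using rep unfolding isometric_representation_def by metis
qed

text \<open>A pair \<open>(u, v)\<close> stands for the class of \<open>e_word u @ f_word v\<close>.
  With this index set, orthogonality is decided by comparing lists instead of congruence
  classes.\<close>

definition degree_words :: "nat \<Rightarrow> nat \<Rightarrow> (nat list \<times> nat list) set" where
  "degree_words k l = {u \<in> lists {1..m}. length u = k} \<times> {v \<in> lists {1..n}. length v = l}"

definition ST_word :: "nat list \<times> nat list \<Rightarrow> 'h \<Rightarrow>\<^sub>L 'h" where
  "ST_word = (\<lambda>(u, v). word_op S u o\<^sub>L word_op T v)"

text \<open>Every class has a representative \<open>e_word u @ f_word v\<close>, on which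
  \<open>degree\<close> and \<open>ST_op\<close> have been evaluated.\<close>

lemma degree_ideal_eq:
  "degree_ideal m n \<theta> S T k l =
    wot_right_ideal_generated (two_graph_algebra m n S T) (ST_word ` degree_words k l)"
proof -
  have "{ST_op m n \<theta> S T w | w. w \<in> two_graph m n \<theta> \<and> degree m n \<theta> w = (k, l)} =
      ST_word ` degree_words k l" (is "?L = ?R")
  proof
    show "?L \<subseteq> ?R"
    proof
      fix A
      assume "A \<in> ?L"
      then obtain w where w: "A = ST_op m n \<theta> S T w" "w \<in> two_graph m n \<theta>"
          "degree m n \<theta> w = (k, l)" by blast
      obtain u v where uv: "u \<in> lists {1..m}" "v \<in> lists {1..n}"
          "w = word_class m n \<theta> (e_word u @ f_word v)"
        using two_graph_e_f_word[OF data w(2)] .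
      with w have "length u = k" "length v = l" "A = ST_word (u, v)"
        by (simp_all add: degree_e_f_word ST_op_e_f_word[OF rep] ST_word_def)
      with uv show "A \<in> ?R"
        by (intro image_eqI[of _ _ "(u, v)"]) (auto simp: degree_words_def)
    qed
    show "?R \<subseteq> ?L"
    proof
      fix A
      assume "A \<in> ?R"
      then obtain u v where uv: "u \<in> lists {1..m}" "length u = k" "v \<in> lists {1..n}"
          "length v = l" and A: "A = ST_word (u, v)"
        unfolding degree_words_def by blast
      let ?w = "word_class m n \<theta> (e_word u @ f_word v)"
      have "?w \<in> two_graph m n \<theta>"
        using uv unfolding two_graph_def by (intro imageI e_f_word_in_gen_words)
      moreover have "degree m n \<theta> ?w = (k, l)" "A = ST_op m n \<theta> S T ?w"
        using uv A by (simp_all add: degree_e_f_word ST_op_e_f_word[OF rep] ST_word_def)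
      ultimately show "A \<in> ?L" by blast
    qed
  qed
  then show ?thesis by (simp add: degree_ideal_def)
qed

text \<open>In the product of an adjoint with another word operator the S-words meet first and then
  the T-words; in both pairs the lengths agree.\<close>

lemma row_isometry_ST_word: "row_isometry (degree_words k l) ST_word"
  unfolding row_isometry_def
proof (intro conjI ballI)
  show "finite (degree_words k l)"
    using finite_lists_length_eq[of "{1..m}" k] finite_lists_length_eq[of "{1..n}" l]
    by (simp add: degree_words_def lists_eq_set)
  have bd: "word_op S u o\<^sub>L word_op T v \<in> bounded_ops" "word_op S u \<in> bounded_ops"
      "word_op T v \<in> bounded_ops"
    if "u \<in> lists {1..m}" "v \<in> lists {1..n}" for u v
    using that word_op_bounded_ops[OF row_isometry_S] word_op_bounded_ops[OF row_isometry_T]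
      unital_subalgebra_compose[OF unital_subalgebra_bounded_ops] by blast+
  show "ST_word ` degree_words k l \<subseteq> bounded_ops"
    using bd by (auto simp: ST_word_def degree_words_def)
  fix w w'
  assume "w \<in> degree_words k l" "w' \<in> degree_words k l"
  then obtain u v u' v' where w: "w = (u, v)" "w' = (u', v')"
      and uv: "u \<in> lists {1..m}" "v \<in> lists {1..n}" "u' \<in> lists {1..m}" "v' \<in> lists {1..n}"
      and len: "length u = length u'" "length v = length v'"
    by (cases w; cases w') (auto simp: degree_words_def)
  have "op_adjoint (ST_word w) = op_adjoint (word_op T v) o\<^sub>L op_adjoint (word_op S u)"
    using bd[OF uv(1,2)] by (simp add: ST_word_def w op_adjoint_compose)
  then show "op_adjoint (ST_word w) o\<^sub>L ST_word w' = (if w = w' then id_blinfun else 0)"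
    using op_adjoint_word_op_apply[OF row_isometry_S len(1) uv(1,3)]
      op_adjoint_word_op_apply[OF row_isometry_T len(2) uv(2,4)]
    by (auto simp: ST_word_def w blinfun.zero_right intro!: blinfun_eqI)
qed

lemma generators_bounded_ops: "S ` {1..m} \<union> T ` {1..n} \<subseteq> bounded_ops"
  using row_isometry_S row_isometry_T by (auto simp: row_isometry_def)

lemma unital_subalgebra_two_graph_algebra: "unital_subalgebra (two_graph_algebra m n S T)"
  unfolding two_graph_algebra_def
  by (rule unital_subalgebra_generated[OF generators_bounded_ops])

lemma ST_word_in_algebra:
  assumes "u \<in> lists {1..m}" "v \<in> lists {1..n}"
  shows "word_op S u o\<^sub>L word_op T v \<in> two_graph_algebra m n S T"
  using generators_subset[of "S ` {1..m} \<union> T ` {1..n}"] assms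
  by (intro unital_subalgebra_compose word_op_in_subalgebra[of _ S "{1..m}"]
      word_op_in_subalgebra[of _ T "{1..n}"] unital_subalgebra_two_graph_algebra)
    (auto simp: two_graph_algebra_def)

lemma S_word_T_exchange:
  assumes "i \<in> {1..m}" "v \<in> lists {1..n}"
  shows "\<exists>v'\<in>lists {1..n}. length v' = length v \<and> (\<exists>B. S i o\<^sub>L word_op T v = word_op T v' o\<^sub>L B)"
proof -
  have "\<exists>j'\<in>{1..n}. \<exists>B\<in>S ` {1..m}. A o\<^sub>L T j = T j' o\<^sub>L B"
    if "A \<in> S ` {1..m}" "j \<in> {1..n}" for A j
    using that S_T_exchange by blast
  from exchange_word_right[OF this imageI[OF assms(1)] assms(2)] show ?thesis by blast
qed

lemma T_S_word_exchange:
  assumes "j \<in> {1..n}" "u \<in> lists {1..m}"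
  shows "\<exists>u'\<in>lists {1..m}. length u' = length u \<and>
    (\<exists>j'\<in>{1..n}. T j o\<^sub>L word_op S u = word_op S u' o\<^sub>L T j')"
proof -
  have "\<exists>i'\<in>{1..m}. \<exists>B\<in>T ` {1..n}. A o\<^sub>L S i = S i' o\<^sub>L B"
    if "A \<in> T ` {1..n}" "i \<in> {1..m}" for A i
    using that T_S_exchange by blast
  from exchange_word_right[OF this imageI[OF assms(1)] assms(2)] show ?thesis by blast
qed

lemma word_S_T_exchange:
  assumes "u \<in> lists {1..m}" "j \<in> {1..n}"
  shows "\<exists>j'\<in>{1..n}. \<exists>u'\<in>lists {1..m}. word_op S u o\<^sub>L T j = T j' o\<^sub>L word_op S u'"
proof -
  have "\<exists>i'\<in>{1..m}. \<exists>B\<in>T ` {1..n}. S i o\<^sub>L A = B o\<^sub>L S i'"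
    if "A \<in> T ` {1..n}" "i \<in> {1..m}" for A i
    using that S_T_exchange by blast
  from exchange_word_left[OF this imageI[OF assms(2)] assms(1)] show ?thesis by blast
qed

text \<open>This is the invariance hypothesis of \<open>range_proj_eq_id\<close>. Left
  multiplication by a generator makes the word one letter too long, and a surplus letter can be
  moved to the far right.\<close>

lemma generator_ST_word_exchange:
  assumes "A \<in> S ` {1..m} \<union> T ` {1..n}" "w \<in> degree_words k l"
  shows "\<exists>w'\<in>degree_words k l. \<exists>B. A o\<^sub>L ST_word w = ST_word w' o\<^sub>L B"
proof -
  obtain u v where w: "w = (u, v)" and u: "u \<in> lists {1..m}" "length u = k"
      and v: "v \<in> lists {1..n}" "length v = l"
    using assms(2) unfolding degree_words_def by blast
  from assms(1) consider i where "i \<in> {1..m}" "A = S i" | j where "j \<in> {1..n}" "A = T j"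
    by blast
  then show ?thesis
  proof cases
    case 1
    \<comment> \<open>Splitting off the last letter of \<open>i # u\<close> leaves an S-word of
      length \<open>k\<close>, also for \<open>k = 0\<close>; the letter \<open>i'\<close> then
      still has to pass the T-word.\<close>
    obtain u' i' where u': "i # u = u' @ [i']"
      by (metis list.distinct(1) rev_exhaust)
    then have "set (u' @ [i']) \<subseteq> {1..m}" "length (u' @ [i']) = Suc k"
      using 1 u by (metis insert_subset list.simps(15) lists_eq_set mem_Collect_eq, metis length_Cons)
    then have u'': "u' \<in> lists {1..m}" "length u' = k" "i' \<in> {1..m}"
      by (auto simp: lists_eq_set)
    obtain v' B where v': "v' \<in> lists {1..n}" "length v' = length v"
        "S i' o\<^sub>L word_op T v = word_op T v' o\<^sub>L B"
      using S_word_T_exchange[OF u''(3) v(1)] by blast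
    have "A o\<^sub>L ST_word w = word_op S (i # u) o\<^sub>L word_op T v"
      by (rule blinfun_eqI) (simp add: 1 w ST_word_def word_op_simps)
    also have "\<dots> = word_op S u' o\<^sub>L (S i' o\<^sub>L word_op T v)"
      by (rule blinfun_eqI) (simp add: u' word_op_append word_op_simps)
    also have "\<dots> = ST_word (u', v') o\<^sub>L B"
      by (rule blinfun_eqI) (simp add: v' ST_word_def)
    finally show ?thesis
      using u'' v' v by (intro bexI[of _ "(u', v')"]) (auto simp: degree_words_def)
  next
    case 2
    obtain u' j' where u': "u' \<in> lists {1..m}" "length u' = length u" "j' \<in> {1..n}"
        "T j o\<^sub>L word_op S u = word_op S u' o\<^sub>L T j'"
      using T_S_word_exchange[OF 2(1) u(1)] by blast
    \<comment> \<open>Once \<open>T j\<close> has passed the S-word, the surplus is in the T-word,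
      whose last letter is already on the far right.\<close>
    obtain v' i where v': "j' # v = v' @ [i]"
      by (metis list.distinct(1) rev_exhaust)
    then have "set (v' @ [i]) \<subseteq> {1..n}" "length (v' @ [i]) = Suc l"
      using u' v by (metis insert_subset list.simps(15) lists_eq_set mem_Collect_eq, metis length_Cons)
    then have v'': "v' \<in> lists {1..n}" "length v' = l"
      by (auto simp: lists_eq_set)
    have "A o\<^sub>L ST_word w = (T j o\<^sub>L word_op S u) o\<^sub>L word_op T v"
      by (rule blinfun_eqI) (simp add: 2 w ST_word_def)
    also have "\<dots> = word_op S u' o\<^sub>L word_op T (j' # v)"
      by (rule blinfun_eqI) (simp add: u' word_op_simps)
    also have "\<dots> = ST_word (u', v') o\<^sub>L T i"
      by (rule blinfun_eqI) (simp add: v' ST_word_def word_op_append word_op_simps)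
    finally show ?thesis
      using v'' u' u by (intro bexI[of _ "(u', v')"]) (auto simp: degree_words_def)
  qed
qed

text \<open>The word is rewritten to begin with a generator of the same kind as \<open>A\<close>;
  the adjoint then cancels that letter or gives zero.\<close>

lemma op_adjoint_generator_ST_word:
  assumes "A \<in> S ` {1..m} \<union> T ` {1..n}" "w \<in> degree_words k l" "k > 0" "l > 0"
  shows "op_adjoint A o\<^sub>L ST_word w \<in> two_graph_algebra m n S T"
proof -
  obtain u v where w: "w = (u, v)" and u: "u \<in> lists {1..m}" "length u = k"
      and v: "v \<in> lists {1..n}" "length v = l"
    using assms(2) unfolding degree_words_def by blast
  note zero = unital_subalgebra_zero[OF unital_subalgebra_two_graph_algebra]
  from assms(1) consider i where "i \<in> {1..m}" "A = S i" | j where "j \<in> {1..n}" "A = T j"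
    by blast
  then show ?thesis
  proof cases
    case 1
    obtain i' u' where u': "u = i' # u'" using u assms(3) by (cases u) auto
    with u have "i' \<in> {1..m}" "u' \<in> lists {1..m}" by auto
    have "op_adjoint A o\<^sub>L ST_word w = (if i = i' then word_op S u' o\<^sub>L word_op T v else 0)"
      using row_isometry_apply[OF row_isometry_S \<open>i \<in> {1..m}\<close> \<open>i' \<in> {1..m}\<close>]
      by (auto simp: 1 w u' ST_word_def word_op_simps intro!: blinfun_eqI)
    then show ?thesis
      using zero ST_word_in_algebra[OF \<open>u' \<in> lists {1..m}\<close> v(1)] by simp
  next
    case 2
    obtain j0 v' where v': "v = j0 # v'" using v assms(4) by (cases v) auto
    with v have v'': "j0 \<in> {1..n}" "v' \<in> lists {1..n}" by auto
    \<comment> \<open>The first T-letter, present because \<open>l > 0\<close>, is moved to the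
      front past the S-word, so that \<open>op_adjoint (T j)\<close> meets a T-letter.\<close>
    obtain u' j' where u': "u' \<in> lists {1..m}" "j' \<in> {1..n}"
        "word_op S u o\<^sub>L T j0 = T j' o\<^sub>L word_op S u'"
      using word_S_T_exchange[OF u(1) v''(1)] by blast
    have "op_adjoint A o\<^sub>L ST_word w = op_adjoint (T j) o\<^sub>L ((word_op S u o\<^sub>L T j0) o\<^sub>L word_op T v')"
      by (rule blinfun_eqI) (simp add: 2 w v' ST_word_def word_op_simps)
    also have "\<dots> = (if j = j' then word_op S u' o\<^sub>L word_op T v' else 0)"
      using row_isometry_apply[OF row_isometry_T \<open>j \<in> {1..n}\<close> \<open>j' \<in> {1..n}\<close>]
      by (auto simp: u' intro!: blinfun_eqI)
    finally show ?thesis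
      using zero ST_word_in_algebra[OF u'(1) v''(2)] by simp
  qed
qed

section \<open>The equivalence\<close>

lemma von_neumann_algebra_iff_id_in_degree_ideal:
  assumes "k > 0" "l > 0"
  shows "von_neumann_algebra (two_graph_algebra m n S T) \<longleftrightarrow>
    id_blinfun \<in> degree_ideal m n \<theta> S T k l"
proof -
  let ?X = "S ` {1..m} \<union> T ` {1..n}"
  let ?\<AA> = "two_graph_algebra m n S T"
  let ?I = "degree_words k l"
  have ST: "ST_word ` ?I \<subseteq> ?\<AA>"
    using ST_word_in_algebra by (auto simp: degree_words_def ST_word_def)
  have "id_blinfun \<in> degree_ideal m n \<theta> S T k l \<longleftrightarrow>
      (\<forall>w\<in>?I. op_adjoint (ST_word w) \<in> ?\<AA>) \<and> range_proj ?I ST_word = id_blinfun"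
    unfolding degree_ideal_eq
    using row_isometry_ST_word unital_subalgebra_two_graph_algebra _ ST
    by (rule id_in_row_ideal_iff)
      (unfold two_graph_algebra_def, rule closedin_wot_generated[OF generators_bounded_ops])
  moreover have "von_neumann_algebra ?\<AA>"
    if adj: "\<forall>w\<in>?I. op_adjoint (ST_word w) \<in> ?\<AA>" and id: "range_proj ?I ST_word = id_blinfun"
    unfolding two_graph_algebra_def
  proof (rule von_neumann_algebra_generatedI[OF generators_bounded_ops], rule image_subsetI)
    fix A
    assume A: "A \<in> ?X"
    \<comment> \<open>Inserting the identity as a sum over words splits \<open>op_adjoint A\<close>
      into products of two factors already known to lie in the algebra.\<close>
    have "op_adjoint A = op_adjoint A o\<^sub>L range_proj ?I ST_word"
      by (rule blinfun_eqI) (simp add: id)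
    also have "\<dots> = (\<Sum>w\<in>?I. (op_adjoint A o\<^sub>L ST_word w) o\<^sub>L op_adjoint (ST_word w))"
      by (rule blinfun_eqI) (simp add: range_proj_apply blinfun.sum_left blinfun.sum_right)
    also have "\<dots> \<in> ?\<AA>"
      by (intro unital_subalgebra_sum unital_subalgebra_compose unital_subalgebra_two_graph_algebra
          op_adjoint_generator_ST_word[OF A _ assms] adj[THEN bspec])
    finally show "op_adjoint A \<in> wot_algebra_generated ?X"
      by (simp add: two_graph_algebra_def)
  qed
  moreover have "(\<forall>w\<in>?I. op_adjoint (ST_word w) \<in> ?\<AA>) \<and> range_proj ?I ST_word = id_blinfun"
    if vN: "von_neumann_algebra ?\<AA>"
  proof
    show "\<forall>w\<in>?I. op_adjoint (ST_word w) \<in> ?\<AA>"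
      using vN ST by (auto simp: von_neumann_algebra_def)
    \<comment> \<open>A witness that the index set is nonempty; the letter 1 exists in both
      alphabets since \<open>m\<close> and \<open>n\<close> are positive.\<close>
    have "(replicate k 1, replicate l 1) \<in> ?I"
      using data by (auto simp: degree_words_def two_graph_data_def lists_eq_set)
    then show "range_proj ?I ST_word = id_blinfun"
      using vN ST generator_ST_word_exchange unfolding two_graph_algebra_def
      by (intro range_proj_eq_id[OF row_isometry_ST_word _ generators_bounded_ops]) auto
  qed
  ultimately show ?thesis by blast
qed

end

theorem theorem5p5:
  fixes m n k l :: nat
    and \<theta> :: "nat \<times> nat \<Rightarrow> nat \<times> nat"
    and S T :: "nat \<Rightarrow> 'h::complex_hilbert_space \<Rightarrow>\<^sub>L 'h"
  assumes "two_graph_data m n \<theta>"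
    and "isometric_representation m n \<theta> S T"
    and "k > 0" and "l > 0"
  shows "von_neumann_algebra (two_graph_algebra m n S T) \<longleftrightarrow>
    id_blinfun \<in> degree_ideal m n \<theta> S T k l"
  using assms by (rule von_neumann_algebra_iff_id_in_degree_ideal)

end
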